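(* Let $\rho$ be a sock ordering. Then $\rho$ is foot-sortable if and only if there exists a word $w$ that represents $\rho$ and avoids the pattern $231$.
   Context: A sock ordering of length $N$ is a finite line (sequence) of $N$ socks, each having a color, where two sequences are considered the same sock ordering if one is obtained from the other by (injectively) renaming colors. Equivalently, a sock ordering of length $N$ is a set partition of $[N]=\{1,\ldots,N\}$, where $i$ and $j$ lie in the same block if and only if the socks in positions $i$ and $j$ have the same color. A sock ordering is sorted if all socks of each color appear consecutively. Foot-sorting algorithm (non-deterministic, one foot): initially the whole sock ordering is a line to the right of the foot, the foot is empty, and there are no socks to the left of the foot. At each point in time one performs one of the following operations: (1) take the leftmost sock that lies to the right of the foot and put it onto the foot, over all socks already on the foot; (2) remove the outermost (most recently put on) sock from the foot and place it to the left of the foot, to the right of all other socks that are to the left of the foot. The process ends when all socks are to the left of the foot; the line of socks on the left is the resulting sock ordering. (Thus the foot is a stack.) A sock ordering is foot-sortable if some choice of operations transforms it into a sorted sock ordering. A word is a finite sequence of positive integers (its letters), possibly with repetitions. A word $w$ of length $N$ represents the set partition of $[N]$ (equivalently, sock ordering) whose blocks are the sets of positions at which the specific letters of $w$ occur. A word $w=w_1\cdots w_N$ avoids the pattern $231$ if there are no indices $i<j<k$ with $w_k<w_i<w_j$. *)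

theory Defs
  imports "HOL-Library.Disjoint_Sets"
begin

text \<open>A sock ordering of length \<open>N\<close> is represented as a set partition of \<open>{1..N}\<close>.\<close>

definition sock_ordering :: "nat \<Rightarrow> nat set set \<Rightarrow> bool" where
  "sock_ordering N \<rho> \<longleftrightarrow> partition_on {1..N} \<rho>"

text \<open>The sock ordering of a line of colours: lists are indexed from 0, positions from 1.
  The same construction gives the set partition represented by a word.\<close>

definition ordering_of :: "'c list \<Rightarrow> nat set set" where
  "ordering_of s = (\<lambda>c. {i \<in> {1..length s}. s ! (i - 1) = c}) ` set s"

definition sorted_ordering :: "nat set set \<Rightarrow> bool" where
  "sorted_ordering \<rho> \<longleftrightarrow> (\<forall>B\<in>\<rho>. \<forall>i j k. i < j \<and> j < k \<and> i \<in> B \<and> k \<in> B \<longrightarrow> j \<in> B)"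

text \<open>As concrete colours for a sock ordering we take its blocks: the sock in position \<open>i\<close>
  has the block containing \<open>i\<close> as its colour.\<close>

definition colour :: "nat set set \<Rightarrow> nat \<Rightarrow> nat set" where
  "colour \<rho> i = (THE B. B \<in> \<rho> \<and> i \<in> B)"

definition sock_line :: "nat \<Rightarrow> nat set set \<Rightarrow> nat set list" where
  "sock_line N \<rho> = map (colour \<rho>) [1..<Suc N]"

lemma ordering_of_sock_line:
  assumes "sock_ordering N \<rho>"
  shows "ordering_of (sock_line N \<rho>) = \<rho>"
proof -
  have part: "partition_on {1..N} \<rho>"
    using assms by (simp add: sock_ordering_def)
  have col: "colour \<rho> i = B" if "B \<in> \<rho>" "i \<in> B" for i B
    unfolding colour_def
    using that partition_onD2[OF part] by (intro the_equality) (auto dest: disjointD)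
  have cover: "\<exists>B\<in>\<rho>. i \<in> B" if "i \<in> {1..N}" for i
    using that partition_onD1[OF part] by blast
  have len: "length (sock_line N \<rho>) = N"
    by (simp add: sock_line_def)
  have nth: "sock_line N \<rho> ! (i - 1) = colour \<rho> i" if "i \<in> {1..N}" for i
    using that by (auto simp: sock_line_def simp del: upt_Suc)
  have blk: "{i \<in> {1..N}. sock_line N \<rho> ! (i - 1) = B} = B" if B: "B \<in> \<rho>" for B
  proof -
    have "B \<subseteq> {1..N}"
      using B partition_onD1[OF part] by blast
    moreover have "i \<in> B" if i: "i \<in> {1..N}" "colour \<rho> i = B" for i
      using cover[OF i(1)] col i(2) by blast
    ultimately show ?thesis
      using nth col[OF B] by blast
  qed
  have "set (sock_line N \<rho>) = colour \<rho> ` {1..N}"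
    by (auto simp: sock_line_def atLeastLessThanSuc_atLeastAtMost simp del: upt_Suc)
  also have "\<dots> = \<rho>"
  proof (intro equalityI subsetI)
    fix B assume "B \<in> colour \<rho> ` {1..N}"
    then show "B \<in> \<rho>" using cover col by fastforce
  next
    fix B assume B: "B \<in> \<rho>"
    then obtain i where "i \<in> B"
      using partition_onD3[OF part] by fastforce
    then show "B \<in> colour \<rho> ` {1..N}"
      using B col partition_onD1[OF part] by blast
  qed
  finally show ?thesis
    using blk by (simp add: ordering_of_def len)
qed

text \<open>A state is (socks left of the foot, socks on the foot, socks right of the foot). The two
  lines are listed from left to right, the socks on the foot from the outermost inwards.\<close>

inductive foot_step ::
    "'c list \<times> 'c list \<times> 'c list \<Rightarrow> 'c list \<times> 'c list \<times> 'c list \<Rightarrow> bool" where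
  put_on: "foot_step (L, F, c # R) (L, c # F, R)"
| take_off: "foot_step (L, c # F, R) (L @ [c], F, R)"

definition foot_sortable :: "nat \<Rightarrow> nat set set \<Rightarrow> bool" where
  "foot_sortable N \<rho> \<longleftrightarrow>
     (\<exists>L. foot_step\<^sup>*\<^sup>* ([], [], sock_line N \<rho>) (L, [], []) \<and> sorted_ordering (ordering_of L))"

definition word :: "nat list \<Rightarrow> bool" where
  "word w \<longleftrightarrow> (\<forall>x\<in>set w. 0 < x)"

definition represents :: "nat list \<Rightarrow> nat set set \<Rightarrow> bool" where
  "represents w \<rho> \<longleftrightarrow> ordering_of w = \<rho>"

definition avoids_231 :: "nat list \<Rightarrow> bool" where
  "avoids_231 w \<longleftrightarrow>
     \<not> (\<exists>i j k. i < j \<and> j < k \<and> k < length w \<and> w ! k < w ! i \<and> w ! i < w ! j)"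

end

theory Submission
  imports Defs
begin

text \<open>
  The foot is a stack, so the theorem is Knuth's characterisation of stack-sortable sequences by
  avoidance of \<open>231\<close>, for sequences with repetitions, combined with the freedom to name the colours.
  A run of the foot does not look at colours, so it commutes with every renaming
  (\<open>foot_steps_map\<close>). Naming each colour by the place where it first leaves the foot turns a sorted
  outcome into a weakly increasing word (\<open>sorted_ordering_imp_sorted_map\<close>); conversely a weakly
  increasing word represents a sorted ordering. Hence a foot-sortable ordering is one represented by
  a word that the foot can make weakly increasing.

  For words of numbers, the right thing to look at in a state \<open>(L, F, R)\<close> is \<open>rev F @ R\<close>, the socks
  that are not yet output in their original order. Putting a sock on the foot leaves this word
  unchanged, and taking one off deletes a letter. The remaining output can be made weakly increasing
  exactly if \<open>F\<close> increases from the outermost sock inwards and \<open>rev F @ R\<close> avoids \<open>231\<close>. Necessity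
  (\<open>sorted_output_imp_avoids_231\<close>) is proved backwards along the run, sufficiency
  (\<open>avoids_231_imp_sorted_output\<close>) by the greedy strategy that takes a sock off as soon as nothing
  smaller is still to come.
\<close>

section \<open>Words avoiding 231\<close>

text \<open>This recursive form, where the first letter is tested in the role of the \<open>2\<close>, lets avoidance
  in concatenations be computed by rewriting instead of by shifting indices.\<close>

lemma avoids_231_Cons:
  "avoids_231 (x # xs) \<longleftrightarrow> sorted_wrt (\<lambda>y z. \<not> (z < x \<and> x < y)) xs \<and> avoids_231 xs"
proof
  assume av: "avoids_231 (x # xs)"
  have "\<not> (xs ! k < x \<and> x < xs ! j)" if "j < k" "k < length xs" for j k
  proof
    assume "xs ! k < x \<and> x < xs ! j"
    with that have "0 < Suc j \<and> Suc j < Suc k \<and> Suc k < length (x # xs) \<and>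
        (x # xs) ! Suc k < (x # xs) ! 0 \<and> (x # xs) ! 0 < (x # xs) ! Suc j"
      by simp
    with av show False unfolding avoids_231_def by blast
  qed
  moreover have "avoids_231 xs"
    unfolding avoids_231_def
  proof clarify
    fix i j k assume "i < j" "j < k" "k < length xs" "xs ! k < xs ! i" "xs ! i < xs ! j"
    then have "Suc i < Suc j \<and> Suc j < Suc k \<and> Suc k < length (x # xs) \<and>
        (x # xs) ! Suc k < (x # xs) ! Suc i \<and> (x # xs) ! Suc i < (x # xs) ! Suc j"
      by simp
    with av show False unfolding avoids_231_def by blast
  qed
  ultimately show "sorted_wrt (\<lambda>y z. \<not> (z < x \<and> x < y)) xs \<and> avoids_231 xs"
    by (simp add: sorted_wrt_iff_nth_less)
next
  assume *: "sorted_wrt (\<lambda>y z. \<not> (z < x \<and> x < y)) xs \<and> avoids_231 xs"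
  show "avoids_231 (x # xs)"
    unfolding avoids_231_def
  proof clarify
    fix i j k assume ijk: "i < j" "j < k" "k < length (x # xs)"
      "(x # xs) ! k < (x # xs) ! i" "(x # xs) ! i < (x # xs) ! j"
    then obtain j' k' where "j = Suc j'" "k = Suc k'"
      by (metis less_nat_zero_code not0_implies_Suc)
    with ijk * show False
      by (cases i) (auto simp: sorted_wrt_iff_nth_less avoids_231_def)
  qed
qed

lemma avoids_231_delete: "avoids_231 (u @ c # v) \<Longrightarrow> avoids_231 (u @ v)"
  by (induction u) (auto simp: avoids_231_Cons sorted_wrt_append)

text \<open>A letter that is minimal in the word can only play the \<open>1\<close> of the pattern, and then the \<open>2\<close> and
  the \<open>3\<close> would form an ascent inside the weakly decreasing \<open>u\<close>.\<close>

lemma avoids_231_insert_minimum: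
  assumes "avoids_231 (u @ v)" and "sorted (rev u)" and "\<forall>x\<in>set (u @ v). c \<le> x"
  shows "avoids_231 (u @ c # v)"
  using assms
proof (induction u)
  case Nil
  have "sorted_wrt (\<lambda>y z. \<not> (z < c \<and> c < y)) v"
    using Nil.prems(3) by (induction v) auto
  with Nil show ?case by (simp add: avoids_231_Cons)
next
  case (Cons x u)
  then show ?case
    by (auto simp: avoids_231_Cons sorted_wrt_append)
qed

lemma avoids_231_appendD:
  assumes "avoids_231 (u @ c # d # v)" "a \<in> set v" "a < c"
  shows "d \<le> c"
  using assms by (induction u) (auto simp: avoids_231_Cons)

section \<open>Runs of the foot\<close>

lemmas rtranclp_induct3 =
  rtranclp_induct[of _ "(ax, ay, az)" "(bx, by, bz)", split_rule,
    consumes 1, case_names refl step]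

lemmas converse_rtranclp_induct3 =
  converse_rtranclp_induct[of _ "(ax, ay, az)" "(bx, by, bz)", split_rule,
    consumes 1, case_names refl step]

lemma foot_steps_map:
  assumes "foot_step\<^sup>*\<^sup>* (L, F, R) (L', F', R')"
  shows "foot_step\<^sup>*\<^sup>* (map f L, map f F, map f R) (map f L', map f F', map f R')"
  using assms
proof (induction rule: rtranclp_induct3)
  case refl
  show ?case by simp
next
  case (step L1 F1 R1 L2 F2 R2)
  from step.hyps(2) have "foot_step (map f L1, map f F1, map f R1) (map f L2, map f F2, map f R2)"
    by cases (auto intro: foot_step.intros)
  with step.IH show ?case by simp
qed

lemma foot_steps_output:
  assumes "foot_step\<^sup>*\<^sup>* (L, F, R) (L', [], [])"
  obtains X where "L' = L @ X" "set X = set F \<union> set R"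
proof -
  have "\<exists>X. L' = L @ X \<and> set X = set F \<union> set R"
    using assms
  proof (induction L F R rule: converse_rtranclp_induct3)
    case refl
    show ?case by simp
  next
    case (step L1 F1 R1 L2 F2 R2)
    from step.hyps(1) step.IH show ?case
      by cases auto
  qed
  with that show thesis by blast
qed

section \<open>Knuth's criterion for words with repetitions\<close>

text \<open>Going backwards, a sock \<open>c\<close> that is taken off is output before everything else that is left, so it
  is minimal among \<open>F\<close> and \<open>R\<close>. Hence it may be prepended to \<open>F\<close>, and putting it back into \<open>rev F @ R\<close>
  creates no \<open>231\<close>.\<close>

lemma sorted_output_imp_avoids_231:
  assumes "foot_step\<^sup>*\<^sup>* (L, F, R) (L', [], [])" and "sorted L'"
  shows "sorted F \<and> avoids_231 (rev F @ R)"
  using assms(1)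
proof (induction L F R rule: converse_rtranclp_induct3)
  case refl
  show ?case by (simp add: avoids_231_def)
next
  case (step L1 F1 R1 L2 F2 R2)
  from step.hyps(1) show ?case
  proof cases
    case (put_on c)
    with step.IH show ?thesis by simp
  next
    case (take_off c)
    from step.hyps(2) obtain X where "L' = L2 @ X" "set X = set F2 \<union> set R2"
      by (rule foot_steps_output)
    with \<open>sorted L'\<close> take_off have "\<forall>x\<in>set (rev F2 @ R2). c \<le> x"
      by (auto simp: sorted_append)
    with step.IH take_off show ?thesis
      using avoids_231_insert_minimum[of "rev F2" R2 c] by auto
  qed
qed

text \<open>Take the outermost sock \<open>c\<close> off if nothing smaller is still to come. Otherwise some \<open>a < c\<close> lies to
  the right, so the next sock \<open>d\<close> cannot exceed \<open>c\<close>, as \<open>c d a\<close> would be a \<open>231\<close>; putting \<open>d\<close> on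
  therefore keeps the foot in order.\<close>

lemma avoids_231_imp_sorted_output:
  assumes "sorted F" and "avoids_231 (rev F @ R)"
  shows "\<exists>X. foot_step\<^sup>*\<^sup>* (L, F, R) (L @ X, [], []) \<and> sorted X"
  using assms
  \<comment> \<open>A sock on the right still takes part in two moves, a sock on the foot in one.\<close>
proof (induction "2 * length R + length F" arbitrary: L F R rule: less_induct)
  case less
  have put: ?case if "R = d # R'" "sorted (d # F)" for d R'
  proof -
    have "foot_step (L, F, R) (L, d # F, R')"
      unfolding that(1) by (rule foot_step.put_on)
    then show ?thesis
      using less.hyps[of R' "d # F" L] less.prems that
      by (auto intro: converse_rtranclp_into_rtranclp)
  qed
  show ?case
  proof (cases F)
    case Nil
    show ?thesis
    proof (cases R)
      case Nil
      have "foot_step\<^sup>*\<^sup>* (L, F, R) (L @ [], [], [])"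
        using \<open>F = []\<close> Nil by simp
      then show ?thesis by (metis sorted_wrt.simps(1))
    next
      case (Cons d R')
      with Nil show ?thesis by (intro put) auto
    qed
  next
    case (Cons c F')
    show ?thesis
    proof (cases "\<forall>a\<in>set R. c \<le> a")
      case True
      have "avoids_231 (rev F' @ R)"
        using less.prems(2) Cons by (auto intro: avoids_231_delete)
      then obtain X where run: "foot_step\<^sup>*\<^sup>* (L @ [c], F', R) ((L @ [c]) @ X, [], [])"
          and X: "sorted X"
        using less.hyps[of R F' "L @ [c]"] less.prems(1) Cons by auto
      have "set X = set F' \<union> set R"
        using run by (rule foot_steps_output) auto
      with X True less.prems(1) Cons have "sorted (c # X)" by auto
      moreover have "foot_step\<^sup>*\<^sup>* (L, F, R) (L @ c # X, [], [])"
        using converse_rtranclp_into_rtranclp[OF foot_step.take_off run] Cons by simp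
      ultimately show ?thesis by blast
    next
      case False
      then obtain a where a: "a \<in> set R" "a < c" by auto
      then obtain d R' where R: "R = d # R'" by (cases R) auto
      have "d \<le> c"
      proof (cases "a = d")
        case False
        with a less.prems(2) Cons R show ?thesis
          by (intro avoids_231_appendD[of "rev F'" c d R' a]) auto
      qed (use a in simp)
      with less.prems(1) Cons have "sorted (d # F)" by auto
      with R show ?thesis by (rule put)
    qed
  qed
qed

section \<open>Orderings and the naming of colours\<close>

definition positions :: "'c list \<Rightarrow> 'c \<Rightarrow> nat set" where
  "positions s c = {i \<in> {1..length s}. s ! (i - 1) = c}"

lemma ordering_of_positions: "ordering_of s = positions s ` set s"
  by (auto simp: ordering_of_def positions_def)

lemma positions_nth: "i < length s \<Longrightarrow> Suc i \<in> positions s (s ! i)"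
  by (simp add: positions_def)

lemma inj_on_positions: "inj_on (positions s) (set s)"
proof (rule inj_onI)
  fix c d assume "c \<in> set s" "positions s c = positions s d"
  moreover from \<open>c \<in> set s\<close> obtain i where "i < length s" "s ! i = c"
    by (auto simp: in_set_conv_nth)
  ultimately have "Suc i \<in> positions s d" using positions_nth[of i s] by simp
  with \<open>s ! i = c\<close> show "c = d" by (simp add: positions_def)
qed

lemma Union_ordering_of: "\<Union> (ordering_of s) = {1..length s}"
  by (auto simp: ordering_of_positions positions_def)

lemma ordering_of_map:
  assumes "inj_on f (set s)"
  shows "ordering_of (map f s) = ordering_of s"
proof -
  have "positions (map f s) (f c) = positions s c" if "c \<in> set s" for c
    using that assms by (auto simp: positions_def inj_on_eq_iff)
  then show ?thesis
    by (auto simp: ordering_of_positions image_image)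
qed

text \<open>The line of socks built from the ordering of a word is that word with each letter renamed to its
  set of positions, so runs can be carried over from the word.\<close>

lemma sock_line_ordering_of: "sock_line (length w) (ordering_of w) = map (positions w) w"
proof (rule nth_equalityI)
  fix i assume "i < length (sock_line (length w) (ordering_of w))"
  then have i: "i < length w" by (simp add: sock_line_def del: upt_Suc)
  have "colour (ordering_of w) (Suc i) = positions w (w ! i)"
    unfolding colour_def
  proof (rule the_equality)
    show "positions w (w ! i) \<in> ordering_of w \<and> Suc i \<in> positions w (w ! i)"
      using i by (simp add: ordering_of_positions positions_nth)
  qed (auto simp: ordering_of_positions positions_def)
  with i show "sock_line (length w) (ordering_of w) ! i = map (positions w) w ! i"
    by (simp add: sock_line_def del: upt_Suc)
qed (simp add: sock_line_def del: upt_Suc)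

lemma sorted_imp_sorted_ordering:
  assumes "sorted (X :: 'c :: linorder list)"
  shows "sorted_ordering (ordering_of X)"
  unfolding sorted_ordering_def
proof clarify
  fix B i j k assume B: "B \<in> ordering_of X" and ijk: "i < j" "j < k" "i \<in> B" "k \<in> B"
  then obtain c where c: "B = positions X c" by (auto simp: ordering_of_positions)
  with ijk have "X ! (i - 1) \<le> X ! (j - 1)" "X ! (j - 1) \<le> X ! (k - 1)"
    using sorted_nth_mono[OF assms, of "i - 1" "j - 1"] sorted_nth_mono[OF assms, of "j - 1" "k - 1"]
    by (auto simp: positions_def)
  with ijk c show "j \<in> B" by (auto simp: positions_def)
qed

text \<open>Name each colour by the position of its first occurrence. If a later sock had a smaller name than
  the one at position \<open>i\<close>, its colour would occur both before and after \<open>i\<close>, but not at \<open>i\<close>.\<close>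

lemma sorted_ordering_imp_sorted_map:
  assumes "sorted_ordering (ordering_of L)"
  obtains f :: "'c \<Rightarrow> nat" where "inj_on f (set L)" "sorted (map f L)" "\<And>c. 0 < f c"
proof -
  define first where "first = (\<lambda>c. LEAST i. L ! i = c)"
  have first: "L ! first (L ! i) = L ! i" "first (L ! i) \<le> i" for i
    unfolding first_def by (rule LeastI, rule refl) (simp add: Least_le)
  have "inj_on (\<lambda>c. Suc (first c)) (set L)"
    by (rule inj_onI) (metis first(1) in_set_conv_nth nat.inject)
  moreover have "first (L ! i) \<le> first (L ! j)" if ij: "i < j" "j < length L" for i j
  proof (rule ccontr)
    assume less: "\<not> first (L ! i) \<le> first (L ! j)"
    then have before: "first (L ! j) < i" using first(2)[of i] by simp
    have "positions L (L ! j) \<in> ordering_of L"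
      using ij by (simp add: ordering_of_positions)
    moreover have "Suc (first (L ! j)) \<in> positions L (L ! j)" "Suc j \<in> positions L (L ! j)"
      using ij before first(1)[of j] by (auto simp: positions_def)
    ultimately have "Suc i \<in> positions L (L ! j)"
      using assms before ij(1) unfolding sorted_ordering_def by (meson Suc_mono)
    then have "L ! i = L ! j" by (simp add: positions_def)
    with less show False by simp
  qed
  then have "sorted (map (\<lambda>c. Suc (first c)) L)"
    by (auto simp: sorted_wrt_iff_nth_less)
  ultimately show thesis using that by blast
qed

section \<open>Foot-sortable orderings\<close>

theorem theorem1p1:
  fixes N :: nat and \<rho> :: "nat set set"
  assumes "sock_ordering N \<rho>"
  shows "foot_sortable N \<rho> \<longleftrightarrow> (\<exists>w. word w \<and> represents w \<rho> \<and> avoids_231 w)"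
proof
  let ?s = "sock_line N \<rho>"
  assume "foot_sortable N \<rho>"
  then obtain L where run: "foot_step\<^sup>*\<^sup>* ([], [], ?s) (L, [], [])"
    and L: "sorted_ordering (ordering_of L)"
    unfolding foot_sortable_def by blast
  from L obtain f :: "nat set \<Rightarrow> nat"
    where f: "inj_on f (set L)" "sorted (map f L)" "\<And>c. 0 < f c"
    by (rule sorted_ordering_imp_sorted_map) blast
  have "set L = set ?s"
    using run by (rule foot_steps_output) simp
  with f(1) have "represents (map f ?s) \<rho>"
    by (simp add: represents_def ordering_of_map ordering_of_sock_line[OF assms])
  moreover have "avoids_231 (map f ?s)"
    using sorted_output_imp_avoids_231[of "[]" "[]" "map f ?s" "map f L"]
      foot_steps_map[OF run, of f] f(2) by simp
  moreover have "word (map f ?s)"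
    using f(3) by (simp add: word_def)
  ultimately show "\<exists>w. word w \<and> represents w \<rho> \<and> avoids_231 w" by blast
next
  assume "\<exists>w. word w \<and> represents w \<rho> \<and> avoids_231 w"
  then obtain w where w: "ordering_of w = \<rho>" "avoids_231 w"
    by (auto simp: represents_def)
  have "{1..N} = {1..length w}"
    using assms w(1) Union_ordering_of[of w] by (auto simp: sock_ordering_def partition_on_def)
  then have "N = length w"
    by (metis card_atLeastAtMost diff_Suc_1)
  with w(1) have line: "sock_line N \<rho> = map (positions w) w"
    using sock_line_ordering_of by blast
  from w(2) obtain X where run: "foot_step\<^sup>*\<^sup>* ([], [], w) (X, [], [])" and X: "sorted X"
    using avoids_231_imp_sorted_output[of "[]" w "[]"] by auto
  have "set X = set w"
    using run by (rule foot_steps_output) simp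
  then have "ordering_of (map (positions w) X) = ordering_of X"
    using inj_on_positions[of w] by (simp add: ordering_of_map)
  with X have "sorted_ordering (ordering_of (map (positions w) X))"
    by (simp add: sorted_imp_sorted_ordering)
  then show "foot_sortable N \<rho>"
    using foot_steps_map[OF run, of "positions w"] line
    by (auto simp: foot_sortable_def)
qed

end
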